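(* Let $S$ be a reflexive topological monoid. Then $S$ is compact if and only if its dual inverse monoid $S^{\odot}$ is discrete; and $S$ is discrete if and only if $S^{\odot}$ is compact.
   Context: All topological spaces are assumed Hausdorff. A monoid is a semigroup with a two-sided unit $1$; a topological monoid is a monoid endowed with a (Hausdorff) topology making the multiplication continuous. A monoid homomorphism $h:S\to M$ is a function with $h(1)=1$ and $h(xy)=h(x)h(y)$ for all $x,y\in S$. Let $\dot{\mathbb T}=\{z\in\mathbb C:|z|\in\{0,1\}\}$, with the multiplication of complex numbers and the topology inherited from $\mathbb C$. For a topological monoid $S$, the dual inverse monoid $S^{\odot}$ is the set of all continuous monoid homomorphisms $S\to\dot{\mathbb T}$, endowed with pointwise multiplication and the compact-open topology; it is again a topological monoid, and $S^{\odot\odot}=(S^{\odot})^{\odot}$. The canonical homomorphism is $\delta_S:S\to S^{\odot\odot}$, $\delta_S(x)(h)=h(x)$ for $x\in S$, $h\in S^{\odot}$. A topological monoid $S$ is reflexive if $\delta_S$ is a topological isomorphism (a monoid isomorphism that is a homeomorphism). *)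

theory Defs
  imports "HOL-Analysis.Analysis" "HOL-Algebra.Group"
begin

record 'a top_monoid = "'a monoid" +
  topol :: "'a topology"

locale topological_monoid = monoid S for S :: "('a, 'b) top_monoid_scheme" (structure) +
  assumes topspace_topol: "topspace (topol S) = carrier S"
    and Hausdorff_topol: "Hausdorff_space (topol S)"
    and continuous_mult:
      "continuous_map (prod_topology (topol S) (topol S)) (topol S) (\<lambda>(x, y). x \<otimes> y)"

definition discrete_top_monoid :: "('a, 'b) top_monoid_scheme \<Rightarrow> bool" where
  "discrete_top_monoid S \<longleftrightarrow> topol S = discrete_topology (carrier S)"

definition compact_top_monoid :: "('a, 'b) top_monoid_scheme \<Rightarrow> bool" where
  "compact_top_monoid S \<longleftrightarrow> compact_space (topol S)"

(* Unlike hom, which only respects the multiplication, this also asks that the unit be preserved;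
   for monoids (e.g. for the zero map into the complex numbers) this is not automatic. *)
definition monoid_hom :: "('a, 'b) monoid_scheme \<Rightarrow> ('c, 'd) monoid_scheme \<Rightarrow> ('a \<Rightarrow> 'c) set" where
  "monoid_hom S M = {h \<in> hom S M. h \<one>\<^bsub>S\<^esub> = \<one>\<^bsub>M\<^esub>}"

definition Tdot :: "complex top_monoid" where
  "Tdot = \<lparr>carrier = {z. cmod z \<in> {0, 1}}, mult = (*), one = 1,
           topol = top_of_set {z. cmod z \<in> {0, 1}}\<rparr>"

(* Continuous maps X -> Y are represented by functions that are undefined outside topspace X, so
   that equal maps are equal functions.  The subbasic sets with K = {} make the whole set of
   continuous maps the underlying space. *)
definition compact_open_topology :: "'a topology \<Rightarrow> 'b topology \<Rightarrow> ('a \<Rightarrow> 'b) topology" where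
  "compact_open_topology X Y = topology_generated_by
     {{f \<in> extensional (topspace X). continuous_map X Y f \<and> f ` K \<subseteq> U} | K U.
        compactin X K \<and> openin Y U}"

definition dual_carrier :: "('a, 'b) top_monoid_scheme \<Rightarrow> ('a \<Rightarrow> complex) set" where
  "dual_carrier S = {h \<in> monoid_hom S Tdot \<inter> extensional (carrier S).
                       continuous_map (topol S) (topol Tdot) h}"

definition dual_monoid :: "('a, 'b) top_monoid_scheme \<Rightarrow> ('a \<Rightarrow> complex) top_monoid" where
  "dual_monoid S =
     \<lparr>carrier = dual_carrier S,
      mult = (\<lambda>g h. \<lambda>x\<in>carrier S. g x \<otimes>\<^bsub>Tdot\<^esub> h x),
      one = (\<lambda>x\<in>carrier S. \<one>\<^bsub>Tdot\<^esub>),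
      topol = subtopology (compact_open_topology (topol S) (topol Tdot)) (dual_carrier S)\<rparr>"

definition canonical_hom :: "('a, 'b) top_monoid_scheme \<Rightarrow> 'a \<Rightarrow> ('a \<Rightarrow> complex) \<Rightarrow> complex" where
  "canonical_hom S = (\<lambda>x\<in>carrier S. \<lambda>h\<in>carrier (dual_monoid S). h x)"

definition topological_iso ::
  "('a, 'b) top_monoid_scheme \<Rightarrow> ('c, 'd) top_monoid_scheme \<Rightarrow> ('a \<Rightarrow> 'c) \<Rightarrow> bool" where
  "topological_iso S M f \<longleftrightarrow>
     f \<in> monoid_hom S M \<and> bij_betw f (carrier S) (carrier M) \<and>
     homeomorphic_map (topol S) (topol M) f"

definition reflexive_monoid :: "('a, 'b) top_monoid_scheme \<Rightarrow> bool" where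
  "reflexive_monoid S \<longleftrightarrow>
     topological_iso S (dual_monoid (dual_monoid S)) (canonical_hom S)"

end

(* Both implications "compact implies discrete dual" and "discrete implies compact dual" hold for
   arbitrary monoids; applied to the dual, they give the converses by reflexivity.
   If S is compact, the compact-open topology is uniform, and two homomorphisms g, h at distance
   less than 3/4 have the same zeros, while at the other points all powers of g x / h x stay within
   3/4 of 1, which forces g x = h x.
   If S is discrete, its compact sets are finite, so the dual carries the topology of pointwise
   convergence and is closed in a power of the compact space Tdot. *)
theory Submission imports Defs begin

section \<open>Complex numbers and complex-valued maps\<close>

text \<open>Squaring \<open>v\<close> multiplies its distance to 1 by \<open>cmod (v + 1)\<close>,
  which is at least 2 - 3/4 = 5/4 as long as \<open>v\<close> is within 3/4 of 1. If
  \<open>w\<close> were not 1, repeated squaring would drive this distance beyond every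
  bound.\<close>

lemma unit_complex_eq_1_if_powers_near_1:
  fixes w :: complex
  assumes w: "cmod w = 1" and near: "\<And>n. cmod (w ^ n - 1) < 3/4"
  shows "w = 1"
proof (rule ccontr)
  assume "w \<noteq> 1"
  then have pos: "cmod (w - 1) > 0" by simp
  have grow: "(5/4) ^ n * cmod (w - 1) \<le> cmod (w ^ (2 ^ n) - 1)" for n
  proof (induction n)
    case (Suc n)
    define v where "v = w ^ (2 ^ n)"
    have "2 - cmod (v - 1) \<le> cmod (v + 1)"
      using norm_triangle_ineq4[of "v + 1" "v - 1"] by simp
    then have "5/4 \<le> cmod (v + 1)"
      using near[of "2 ^ n"] unfolding v_def by linarith
    then have "5/4 * ((5/4) ^ n * cmod (w - 1)) \<le> cmod (v + 1) * cmod (v - 1)"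
      using Suc unfolding v_def by (intro mult_mono) auto
    also have "\<dots> = cmod (w ^ (2 ^ Suc n) - 1)"
      unfolding v_def norm_mult[symmetric]
      by (simp add: algebra_simps power2_eq_square flip: power_add) (simp add: mult_2)
    finally show ?case by simp
  qed simp
  obtain n where "1 / cmod (w - 1) < (5/4) ^ n"
    using real_arch_pow[of "5/4"] by auto
  then have "1 < (5/4) ^ n * cmod (w - 1)"
    using pos by (simp add: divide_simps)
  with grow[of n] near[of "2 ^ n"] show False by linarith
qed

lemma continuous_map_mult:
  fixes f g :: "'a \<Rightarrow> 'b::real_normed_algebra"
  assumes "continuous_map X euclidean f" "continuous_map X euclidean g"
  shows "continuous_map X euclidean (\<lambda>x. f x * g x)"
  using assms by (simp add: continuous_map_atin tendsto_mult)

section \<open>The dual as a monoid and as a space\<close>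

lemma Tdot_simps [simp]:
  "carrier Tdot = {z. cmod z \<in> {0, 1}}" "mult Tdot = (*)" "one Tdot = 1"
  "topol Tdot = top_of_set {z. cmod z \<in> {0, 1}}"
  by (simp_all add: Tdot_def)

lemma compact_Tdot: "compact {z :: complex. cmod z \<in> {0, 1}}"
proof -
  have "{z :: complex. cmod z \<in> {0, 1}} = insert 0 (sphere 0 1)"
    by auto
  then show ?thesis by simp
qed

lemma dual_carrierD:
  assumes "h \<in> dual_carrier S"
  shows "\<And>x. x \<in> carrier S \<Longrightarrow> cmod (h x) \<in> {0, 1}"
    and "\<And>x y. x \<in> carrier S \<Longrightarrow> y \<in> carrier S \<Longrightarrow> h (x \<otimes>\<^bsub>S\<^esub> y) = h x * h y"
    and "h \<one>\<^bsub>S\<^esub> = 1" and "h \<in> extensional (carrier S)"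
    and "continuous_map (topol S) (top_of_set {z. cmod z \<in> {0, 1}}) h"
  using assms by (auto simp: dual_carrier_def monoid_hom_def hom_def Pi_def)

lemma dual_carrier_pow:
  assumes "monoid S" "h \<in> dual_carrier S" "x \<in> carrier S"
  shows "h (x [^]\<^bsub>S\<^esub> (n::nat)) = h x ^ n"
proof -
  interpret monoid S by fact
  show ?thesis
    using assms by (induction n) (simp_all add: dual_carrierD mult.commute)
qed

lemma dual_monoid_simps [simp]:
  "carrier (dual_monoid S) = dual_carrier S"
  "mult (dual_monoid S) = (\<lambda>g h. \<lambda>x\<in>carrier S. g x * h x)"
  "one (dual_monoid S) = (\<lambda>x\<in>carrier S. 1)"
  "topol (dual_monoid S) =
     subtopology (compact_open_topology (topol S) (topol Tdot)) (dual_carrier S)"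
  by (simp_all add: dual_monoid_def)

lemma openin_compact_open:
  assumes "compactin X K" "openin Y U"
  shows "openin (compact_open_topology X Y)
           {f \<in> extensional (topspace X). continuous_map X Y f \<and> f ` K \<subseteq> U}"
  unfolding compact_open_topology_def
  by (rule topology_generated_by_Basis) (use assms in auto)

lemma topspace_compact_open:
  "topspace (compact_open_topology X Y) = {f \<in> extensional (topspace X). continuous_map X Y f}"
proof
  show "topspace (compact_open_topology X Y) \<subseteq> {f \<in> extensional (topspace X). continuous_map X Y f}"
    unfolding compact_open_topology_def topology_generated_by_topspace by auto
  show "{f \<in> extensional (topspace X). continuous_map X Y f} \<subseteq> topspace (compact_open_topology X Y)"
    using openin_subset[OF openin_compact_open[of X "{}" Y "{}"]] by simp
qed

lemma topspace_dual:
  assumes "topspace (topol S) = carrier S"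
  shows "topspace (topol (dual_monoid S)) = dual_carrier S"
  using assms by (auto simp: topspace_compact_open dual_carrier_def)

text \<open>Together with \<open>topspace_dual\<close>, this makes the two implications proved below
  applicable to the dual itself, and so yields statements about the bidual.\<close>

lemma monoid_dual:
  assumes "monoid S" and top: "topspace (topol S) = carrier S"
  shows "monoid (dual_monoid S)"
proof -
  interpret monoid S by fact
  have mult: "(\<lambda>x\<in>carrier S. g x * h x) \<in> dual_carrier S"
    if g: "g \<in> dual_carrier S" and h: "h \<in> dual_carrier S" for g h
  proof -
    have "continuous_map (topol S) euclidean (\<lambda>x. g x * h x)"
      using dual_carrierD(5)[OF g] dual_carrierD(5)[OF h]
      by (intro continuous_map_mult) (auto simp: continuous_map_in_subtopology)
    \<comment> \<open>Restriction alters the product only outside the underlying space, so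
      continuity is not affected.\<close>
    then have "continuous_map (topol S) euclidean (\<lambda>x\<in>carrier S. g x * h x)"
      by (rule continuous_map_eq) (simp add: top)
    moreover have "cmod (g x * h x) \<in> {0, 1}" if "x \<in> carrier S" for x
      using dual_carrierD(1)[OF g that] dual_carrierD(1)[OF h that] by (auto simp: norm_mult)
    ultimately show ?thesis
      using g h
      by (auto simp: dual_carrier_def monoid_hom_def hom_def continuous_map_in_subtopology top)
  qed
  have one: "(\<lambda>x\<in>carrier S. 1) \<in> dual_carrier S"
  proof -
    have "continuous_map (topol S) euclidean (\<lambda>x\<in>carrier S. 1::complex)"
      by (rule continuous_map_eq[of _ _ "\<lambda>x. 1"]) (simp_all add: top)
    then show ?thesis
      by (auto simp: dual_carrier_def monoid_hom_def hom_def continuous_map_in_subtopology top)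
  qed
  show ?thesis
  proof (rule monoidI)
    fix h assume "h \<in> carrier (dual_monoid S)"
    then have ext: "h \<in> extensional (carrier S)"
      by (simp add: dual_carrierD)
    show "\<one>\<^bsub>dual_monoid S\<^esub> \<otimes>\<^bsub>dual_monoid S\<^esub> h = h" "h \<otimes>\<^bsub>dual_monoid S\<^esub> \<one>\<^bsub>dual_monoid S\<^esub> = h"
      by (auto intro!: extensionalityI[OF _ ext])
  qed (use mult one in \<open>auto simp: restrict_def fun_eq_iff\<close>)
qed

section \<open>Compact monoids have discrete duals\<close>

lemma discrete_dual_if_compact:
  assumes "monoid S" and top: "topspace (topol S) = carrier S" and "compact_top_monoid S"
  shows "discrete_top_monoid (dual_monoid S)"
proof -
  interpret monoid S by fact
  let ?T = "{z :: complex. cmod z \<in> {0, 1}}"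
  obtain F where F: "finite F" "?T \<subseteq> (\<Union>c\<in>F. ball c (1/4))"
    using compact_Tdot unfolding compact_eq_totally_bounded
    by (metis zero_less_divide_1_iff zero_less_numeral)
  have "openin (topol (dual_monoid S)) {h}" if h: "h \<in> dual_carrier S" for h
  proof -
    \<comment> \<open>The closed ball makes \<open>?K c\<close> closed, hence compact, so
      \<open>?N c\<close> is subbasic. The larger radius 1/2 keeps \<open>h\<close> itself in
      \<open>?N c\<close>. Any other member of all the \<open>?N c\<close> lies within 1/2 + 1/4 =
      3/4 of \<open>h\<close> everywhere, because the balls of radius 1/4 about \<open>F\<close>
      cover all values of \<open>h\<close>.\<close>
    let ?K = "\<lambda>c. {x \<in> topspace (topol S). h x \<in> ?T \<inter> cball c (1/4)}"
    let ?N = "\<lambda>c. {f \<in> extensional (topspace (topol S)). continuous_map (topol S) (topol Tdot) f \<and>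
      f ` ?K c \<subseteq> ?T \<inter> ball c (1/2)}"
    let ?W = "topspace (topol (dual_monoid S)) \<inter> (\<Inter>c\<in>F. dual_carrier S \<inter> ?N c)"
    have "openin (topol (dual_monoid S)) (dual_carrier S \<inter> ?N c)" for c
    proof -
      have "closedin (topol S) (?K c)"
        by (rule closedin_continuous_map_preimage[OF dual_carrierD(5)[OF h]])
           (auto simp: closedin_closed)
      then have "compactin (topol S) (?K c)"
        using assms(3) by (simp add: compact_top_monoid_def closedin_compact_space)
      moreover have "openin (topol Tdot) (?T \<inter> ball c (1/2))"
        unfolding Tdot_simps by (intro openin_open_Int) simp
      ultimately show ?thesis
        unfolding dual_monoid_simps by (intro openin_subtopology_Int2 openin_compact_open)
    qed
    moreover have "F \<noteq> {}"
      using F(2) by (metis UN_empty empty_iff insert_iff mem_Collect_eq norm_one subset_empty)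
    ultimately have "openin (topol (dual_monoid S)) ?W"
      using F(1) by (intro openin_Int[OF openin_topspace] openin_INT2)
    moreover have "?W = {h}"
    proof
      have "h x \<in> ball c (1/2)" if "h x \<in> cball c (1/4)" for x c
        using that by simp
      then have "h \<in> ?N c" for c
        using dual_carrierD[OF h] top by (auto simp: continuous_map_def)
      then show "{h} \<subseteq> ?W"
        using h topspace_dual[OF top] by blast
      show "?W \<subseteq> {h}"
      proof
        fix g assume gW: "g \<in> ?W"
        then have g: "g \<in> dual_carrier S"
          using topspace_dual[OF top] by blast
        have close: "cmod (g x - h x) < 3/4" if x: "x \<in> carrier S" for x
        proof -
          have hx: "h x \<in> ?T"
            using dual_carrierD(1)[OF h x] by simp
          with F(2) obtain c where c: "c \<in> F" "h x \<in> ball c (1/4)"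
            by blast
          then have "x \<in> ?K c"
            using hx x top by auto
          moreover have "g ` ?K c \<subseteq> ball c (1/2)"
            using gW c(1) by blast
          ultimately have "g x \<in> ball c (1/2)"
            by blast
          then show ?thesis
            using c(2) dist_triangle2[of "g x" "h x" c] by (simp add: dist_norm norm_minus_commute)
        qed
        have "g x = h x" if x: "x \<in> carrier S" for x
        \<comment> \<open>Nonzero values have modulus 1 > 3/4, so \<open>g\<close> and
          \<open>h\<close> vanish at the same points.\<close>
        proof (cases "h x = 0")
          case True
          then show ?thesis
            using close[OF x] dual_carrierD(1)[OF g x] by auto
        next
          case False
          then have h1: "cmod (h x) = 1"
            using dual_carrierD(1)[OF h x] by simp
          then have "g x \<noteq> 0"
            using close[OF x] by auto
          then have g1: "cmod (g x) = 1"
            using dual_carrierD(1)[OF g x] by simp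
          \<comment> \<open>The uniform bound is used at the point \<open>x [^] n\<close>, where the
            values are \<open>g x ^ n\<close> and \<open>h x ^ n\<close>; division by
            \<open>h x ^ n\<close>, of modulus 1, preserves it.\<close>
          have "cmod ((g x / h x) ^ n - 1) < 3/4" for n
          proof -
            have "cmod (g x ^ n - h x ^ n) < 3/4"
              using close[of "x [^]\<^bsub>S\<^esub> n"] x g h
              by (simp add: dual_carrier_pow[OF \<open>monoid S\<close>])
            moreover have "(g x / h x) ^ n - 1 = (g x ^ n - h x ^ n) / h x ^ n"
              using False by (simp add: field_simps)
            ultimately show ?thesis
              using h1 by (simp add: norm_divide norm_power)
          qed
          then have "g x / h x = 1"
            by (intro unit_complex_eq_1_if_powers_near_1) (simp add: norm_divide g1 h1)
          then show ?thesis
            using False by simp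
        qed
        then have "g = h"
          using dual_carrierD(4)[OF g] dual_carrierD(4)[OF h] by (metis extensionalityI)
        then show "g \<in> {h}" by simp
      qed
    qed
    ultimately show ?thesis by simp
  qed
  then show ?thesis
    unfolding discrete_top_monoid_def
    using topspace_dual[OF top] discrete_topology_unique[of "dual_carrier S" "topol (dual_monoid S)"]
    by auto
qed

section \<open>Discrete monoids have compact duals\<close>

lemma compact_dual_if_discrete:
  assumes "monoid S" and "discrete_top_monoid S"
  shows "compact_top_monoid (dual_monoid S)"
proof -
  interpret monoid S by fact
  let ?T = "{z :: complex. cmod z \<in> {0, 1}}"
  have disc: "topol S = discrete_topology (carrier S)"
    using assms(2) by (simp add: discrete_top_monoid_def)
  define P where "P = product_topology (\<lambda>_. top_of_set ?T) (carrier S)"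
  have topP: "topspace P = (\<Pi>\<^sub>E x\<in>carrier S. ?T)"
    by (simp add: P_def)
  have proj: "continuous_map P (top_of_set ?T) (\<lambda>f. f x)" if "x \<in> carrier S" for x
    unfolding P_def using that by (rule continuous_map_product_projection)
  then have proj': "continuous_map P euclidean (\<lambda>f. f x)" if "x \<in> carrier S" for x
    using that by (simp add: continuous_map_in_subtopology)
  \<comment> \<open>Every map on a discrete space is continuous, so the dual is cut out of the power
    by the homomorphism equations alone. Each equates two continuous functions of \<open>f\<close>
    and hence defines a closed set.\<close>
  have eq: "dual_carrier S = topspace P \<inter> {f \<in> topspace P. f \<one>\<^bsub>S\<^esub> = 1} \<inter>
    (\<Inter>x\<in>carrier S. \<Inter>y\<in>carrier S. {f \<in> topspace P. f (x \<otimes>\<^bsub>S\<^esub> y) = f x * f y})"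
    unfolding topP dual_carrier_def monoid_hom_def hom_def disc
    by (auto simp: PiE_def Pi_def)
  have "closedin P {f \<in> topspace P. f \<one>\<^bsub>S\<^esub> = 1}"
    by (rule closedin_continuous_maps_eq[of euclidean]) (auto intro: proj')
  moreover have "closedin P {f \<in> topspace P. f (x \<otimes>\<^bsub>S\<^esub> y) = f x * f y}"
    if "x \<in> carrier S" "y \<in> carrier S" for x y
    by (rule closedin_continuous_maps_eq[of euclidean])
       (use that in \<open>auto intro!: proj' continuous_map_mult\<close>)
  moreover have "carrier S \<noteq> {}"
    using one_closed by blast
  ultimately have "closedin P (dual_carrier S)"
    unfolding eq by (intro closedin_Int closedin_INT) auto
  moreover have "compact_space (top_of_set ?T)"
    using compact_Tdot by (intro compact_space_subtopology) (simp only: compactin_euclidean_iff)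
  then have "compact_space P"
    unfolding P_def compact_space_product_topology by blast
  ultimately have comp: "compact_space (subtopology P (dual_carrier S))"
    by (simp add: closedin_compact_space compact_space_subtopology)
  let ?G = "\<lambda>K U. {f \<in> extensional (carrier S).
    continuous_map (topol S) (topol Tdot) f \<and> f ` K \<subseteq> U}"
  \<comment> \<open>Compact subsets of a discrete space are finite, so a subbasic set is a finite
    intersection of preimages under projections. For empty \<open>K\<close> it is all of
    \<open>P\<close>.\<close>
  have basic: "openin P (?G K U)"
    if K: "compactin (topol S) K" and U: "openin (topol Tdot) U" for K U
  proof -
    have "finite K" "K \<subseteq> carrier S"
      using K by (auto simp: disc compactin_discrete_topology)
    then have "openin P (topspace P \<inter> (\<Inter>x\<in>K. {f \<in> topspace P. f x \<in> U}))"
      using U openin_continuous_map_preimage[OF proj]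
      by (cases "K = {}") (auto intro!: openin_Int openin_INT2)
    moreover have "?G K U = topspace P \<inter> (\<Inter>x\<in>K. {f \<in> topspace P. f x \<in> U})"
      unfolding topP disc by (auto simp: PiE_def Pi_def)
    ultimately show ?thesis by simp
  qed
  \<comment> \<open>This direction of the comparison of topologies suffices: the identity then
    exhibits the dual as a continuous image of a compact space.\<close>
  have "continuous_map P (compact_open_topology (topol S) (topol Tdot)) id"
    unfolding compact_open_topology_def
  proof (rule continuous_on_generated_topo)
    fix V assume "V \<in> {{f \<in> extensional (topspace (topol S)). continuous_map (topol S) (topol Tdot) f
      \<and> f ` K \<subseteq> U} |K U. compactin (topol S) K \<and> openin (topol Tdot) U}"
    then obtain K U where "V = ?G K U" "compactin (topol S) K" "openin (topol Tdot) U"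
      by (auto simp: disc)
    then show "openin P (id -` V \<inter> topspace P)"
      using basic by (simp add: openin_Int)
  next
    have "topspace P \<subseteq> topspace (compact_open_topology (topol S) (topol Tdot))"
      unfolding topspace_compact_open topP disc by (auto simp: PiE_def)
    then show "id ` topspace P \<subseteq> \<Union> {{f \<in> extensional (topspace (topol S)).
      continuous_map (topol S) (topol Tdot) f \<and> f ` K \<subseteq> U} |K U.
      compactin (topol S) K \<and> openin (topol Tdot) U}"
      unfolding compact_open_topology_def topology_generated_by_topspace by simp
  qed
  then have cont: "continuous_map (subtopology P (dual_carrier S)) (topol (dual_monoid S)) id"
    by (auto simp: continuous_map_in_subtopology continuous_map_from_subtopology)
  have sub: "dual_carrier S \<subseteq> topspace P"
    using eq by blast
  have "topspace (topol (dual_monoid S)) = dual_carrier S"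
    by (rule topspace_dual) (simp add: disc)
  then show ?thesis
    using image_compactin[OF _ cont, of "dual_carrier S"] comp sub
    by (simp add: compact_top_monoid_def compact_space_def Int_absorb1)
qed

section \<open>Both equivalences through the bidual\<close>

theorem corollary1:
  fixes S :: "'a top_monoid"
  assumes "topological_monoid S"
    and "reflexive_monoid S"
  shows "(compact_top_monoid S \<longleftrightarrow> discrete_top_monoid (dual_monoid S)) \<and>
         (discrete_top_monoid S \<longleftrightarrow> compact_top_monoid (dual_monoid S))"
proof -
  interpret topological_monoid S by fact
  let ?D = "dual_monoid S"
  have S: "monoid S" by unfold_locales
  note top = topspace_topol
  have D: "monoid ?D" "topspace (topol ?D) = carrier ?D"
    using monoid_dual[OF S top] topspace_dual[OF top] by auto
  have homeo: "homeomorphic_map (topol S) (topol (dual_monoid ?D)) (canonical_hom S)"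
    using assms(2) by (simp only: reflexive_monoid_def topological_iso_def)
  have compact: "compact_top_monoid S" if "compact_top_monoid (dual_monoid ?D)"
    using that homeomorphic_compact_space[OF homeomorphic_map_imp_homeomorphic_space[OF homeo]]
    unfolding compact_top_monoid_def by blast
  have discrete: "discrete_top_monoid S" if disc: "discrete_top_monoid (dual_monoid ?D)"
  proof -
    \<comment> \<open>A homeomorphism sends the singleton to a singleton, which is open in the
      discrete bidual, and openness can be pulled back.\<close>
    have "openin (topol S) {x}" if x: "x \<in> carrier S" for x
    proof -
      have "canonical_hom S ` {x} \<subseteq> topspace (topol (dual_monoid ?D))"
        using homeomorphic_imp_surjective_map[OF homeo] x top by blast
      then have "openin (topol (dual_monoid ?D)) (canonical_hom S ` {x})"
        using disc unfolding discrete_top_monoid_def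
        by (metis openin_discrete_topology topspace_discrete_topology)
      then show ?thesis
        using homeomorphic_map_openness[OF homeo, of "{x}"] x top by simp
    qed
    then show ?thesis
      unfolding discrete_top_monoid_def
      using top discrete_topology_unique[of "carrier S" "topol S"] by auto
  qed
  show ?thesis
    \<comment> \<open>The forward implications are the lemmas for \<open>S\<close>. For the
      converses, a discrete \<open>?D\<close> has a compact dual and a compact \<open>?D\<close> has
      a discrete one; this dual is the bidual of \<open>S\<close>, from which \<open>compact\<close>
      and \<open>discrete\<close> return to \<open>S\<close>.\<close>
    using discrete_dual_if_compact[OF S top] compact_dual_if_discrete[OF S]
      discrete_dual_if_compact[OF D] compact_dual_if_discrete[OF D(1)] compact discrete
    by blast
qed

end
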